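(* Let $G$ be a finite group and let $p$ be a prime. If $G$ is $p$-solvable of $p$-length $k$, then $d_{p'}(G)\le \big(2/(p+1)\big)^{k-1}$.
   Context: For a finite group $G$ and prime $p$, $k_{p'}(G)$ denotes the number of conjugacy classes of elements of $G$ whose order is not divisible by $p$, $|G|_{p'}$ is the largest divisor of $|G|$ coprime to $p$, and $d_{p'}(G)=k_{p'}(G)/|G|_{p'}$. $G$ is $p$-solvable if it has a normal series each of whose factors is a $p$-group or a group of order coprime to $p$; its $p$-length is the minimum number of factors that are $p$-groups among such normal series. *)

theory Defs
  imports "HOL-Algebra.Algebra" "HOL-Computational_Algebra.Primes"
begin

definition conj_class :: "('a, 'b) monoid_scheme \<Rightarrow> 'a \<Rightarrow> 'a set" where
  "conj_class G x = {g \<otimes>\<^bsub>G\<^esub> x \<otimes>\<^bsub>G\<^esub> inv\<^bsub>G\<^esub> g | g. g \<in> carrier G}"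

definition p'_elements :: "('a, 'b) monoid_scheme \<Rightarrow> nat \<Rightarrow> 'a set" where
  "p'_elements G p = {x \<in> carrier G. \<not> p dvd group.ord G x}"

definition k_p' :: "('a, 'b) monoid_scheme \<Rightarrow> nat \<Rightarrow> nat" where
  "k_p' G p = card (conj_class G ` p'_elements G p)"

definition order_p' :: "('a, 'b) monoid_scheme \<Rightarrow> nat \<Rightarrow> nat" where
  "order_p' G p = Max {d. d dvd order G \<and> coprime d p}"

definition d_p' :: "('a, 'b) monoid_scheme \<Rightarrow> nat \<Rightarrow> real" where
  "d_p' G p = real (k_p' G p) / real (order_p' G p)"

definition factor_order :: "(nat \<Rightarrow> 'a set) \<Rightarrow> nat \<Rightarrow> nat" where
  "factor_order H i = card (H (Suc i)) div card (H i)"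

definition p_series :: "('a, 'b) monoid_scheme \<Rightarrow> nat \<Rightarrow> nat \<Rightarrow> (nat \<Rightarrow> 'a set) \<Rightarrow> bool" where
  "p_series G p n H \<longleftrightarrow>
     H 0 = {\<one>\<^bsub>G\<^esub>} \<and> H n = carrier G \<and>
     (\<forall>i\<le>n. H i \<lhd> G) \<and> (\<forall>i<n. H i \<subseteq> H (Suc i)) \<and>
     (\<forall>i<n. (\<exists>m. factor_order H i = p ^ m) \<or> coprime (factor_order H i) p)"

definition num_p_factors :: "nat \<Rightarrow> nat \<Rightarrow> (nat \<Rightarrow> 'a set) \<Rightarrow> nat" where
  "num_p_factors p n H = card {i. i < n \<and> (\<exists>m>0. factor_order H i = p ^ m)}"

definition p_solvable :: "('a, 'b) monoid_scheme \<Rightarrow> nat \<Rightarrow> bool" where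
  "p_solvable G p \<longleftrightarrow> (\<exists>n H. p_series G p n H)"

definition p_length :: "('a, 'b) monoid_scheme \<Rightarrow> nat \<Rightarrow> nat" where
  "p_length G p = (LEAST k. \<exists>n H. p_series G p n H \<and> num_p_factors p n H = k)"

end

theory Submission
  imports Defs "HOL-Number_Theory.Cong"
begin

text \<open>For normal \<open>N\<close>, every coset of \<open>N\<close> contains at most as many \<open>N\<close>-orbits of \<open>p'\<close>-elements
  as \<open>N\<close> itself; this follows from Burnside's count by shifting the \<open>p\<close>-part of one member of a
  commuting pair to the other. Hence \<open>k_p' G\<close> is at most \<open>k_p' N\<close> times the number of classes of
  \<open>G / N\<close> containing images of \<open>p'\<close>-elements. If \<open>G / N\<close> is a \<open>p\<close>-group, there is one such class;
  if it is a \<open>p'\<close>-group, there are at most \<open>card (G / N)\<close>; in both cases \<open>d_p' G \<le> d_p' N\<close>.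

  If \<open>G / L\<close> has a normal \<open>p'\<close>-subgroup \<open>K\<close> whose quotient is a \<open>p\<close>-group, only the orbits on \<open>K\<close>
  matter. A Sylow \<open>p\<close>-subgroup \<open>P\<close> acting nontrivially on \<open>K\<close> has fixed points of index at least
  \<open>p + 1\<close>, and all other \<open>P\<close>-orbits have length at least \<open>p\<close>, which leaves at most
  \<open>2 * card K / (p + 1)\<close> orbits. If \<open>P\<close> acts trivially, it is normal in \<open>G / L\<close>, and the
  \<open>p\<close>-factor can be moved below \<open>K\<close>. In a series with the least number of \<open>p\<close>-factors this is
  impossible for each \<open>p\<close>-factor after the first.\<close>

section \<open>Counting orbits\<close>

definition fixed_points :: "('a, 'b) monoid_scheme \<Rightarrow> 'c set \<Rightarrow> ('a \<Rightarrow> 'c \<Rightarrow> 'c) \<Rightarrow> 'c set" where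
  "fixed_points G E \<phi> = {x \<in> E. \<forall>g\<in>carrier G. \<phi> g x = x}"

definition nontrivial_orbits ::
    "('a, 'b) monoid_scheme \<Rightarrow> 'c set \<Rightarrow> ('a \<Rightarrow> 'c \<Rightarrow> 'c) \<Rightarrow> 'c set set" where
  "nontrivial_orbits G E \<phi> = orbits G E \<phi> - (\<lambda>x. {x}) ` fixed_points G E \<phi>"

context group_action
begin

lemma orbit_eqI:
  assumes "x \<in> E" and "y \<in> orbit G \<phi> x"
  shows "orbit G \<phi> y = orbit G \<phi> x"
proof -
  have "y \<in> E"
    using assms element_image by (auto simp: orbit_def)
  then show ?thesis
    using disjoint_union[of "orbit G \<phi> x" "orbit G \<phi> y"] assms orbit_refl[of y]
    by (auto simp: orbits_def)
qed

lemma card_orbits_mult_order: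
  assumes "finite (carrier G)" and "finite E"
  shows "card (orbits G E \<phi>) * order G = (\<Sum>x\<in>E. card (stabilizer G \<phi> x))"
  using disjoint_sum[OF assms(2), of "\<lambda>x. card (stabilizer G \<phi> x)"]
  by (simp add: card_stablizer_sum[OF assms(1)])

lemma orbit_eq_singleton_iff:
  assumes "x \<in> E"
  shows "orbit G \<phi> x = {x} \<longleftrightarrow> x \<in> fixed_points G E \<phi>"
  using assms orbit_refl[OF assms] by (auto simp: orbit_def fixed_points_def)

lemma
  assumes fin: "finite E"
  shows card_orbits_eq_fixed_points:
      "card (orbits G E \<phi>) = card (fixed_points G E \<phi>) + card (nontrivial_orbits G E \<phi>)"
    and card_eq_fixed_points:
      "card E = card (fixed_points G E \<phi>) + (\<Sum>w\<in>nontrivial_orbits G E \<phi>. card w)"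
proof -
  let ?S = "(\<lambda>x. {x}) ` fixed_points G E \<phi>"
  have "{x} \<in> orbits G E \<phi>" if "x \<in> fixed_points G E \<phi>" for x
    using that orbit_eq_singleton_iff[of x] by (auto simp: orbits_def fixed_points_def)
  then have sub: "?S \<subseteq> orbits G E \<phi>"
    by auto
  have fin_orbits: "finite (orbits G E \<phi>)"
    using fin orbits_coverture by (metis finite_UnionD)
  have card: "card ?S = card (fixed_points G E \<phi>)"
    by (simp add: card_image)
  then show "card (orbits G E \<phi>) = card (fixed_points G E \<phi>) + card (nontrivial_orbits G E \<phi>)"
    using card_Diff_subset[OF finite_subset[OF sub fin_orbits] sub] card_mono[OF fin_orbits sub]
    by (simp add: nontrivial_orbits_def)
  have "card E = (\<Sum>w\<in>orbits G E \<phi>. card w)"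
    using disjoint_sum[OF fin, of "\<lambda>_. 1::nat"] by simp
  also have "\<dots> = (\<Sum>w\<in>nontrivial_orbits G E \<phi>. card w) + (\<Sum>w\<in>?S. card w)"
    unfolding nontrivial_orbits_def by (rule sum.subset_diff[OF sub fin_orbits])
  also have "(\<Sum>w\<in>?S. card w) = card ?S"
    by (simp add: sum.reindex card_image)
  finally show "card E = card (fixed_points G E \<phi>) + (\<Sum>w\<in>nontrivial_orbits G E \<phi>. card w)"
    by (simp add: card)
qed

lemma p_group_dvd_card_nontrivial_orbit:
  assumes p: "Factorial_Ring.prime p" and ord: "order G = p ^ n"
    and w: "w \<in> nontrivial_orbits G E \<phi>"
  shows "p dvd card w"
proof -
  obtain x where x: "x \<in> E" "w = orbit G \<phi> x"
    using w by (auto simp: nontrivial_orbits_def orbits_def)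
  have "card w dvd p ^ n"
    using orbit_stabilizer_theorem[OF x(1)] x(2) by (metis dvd_triv_left ord)
  then obtain i where i: "card w = p ^ i"
    using p divides_primepow_nat by blast
  have "i \<noteq> 0"
  proof
    assume "i = 0"
    then have "w = {x}"
      using i orbit_refl[OF x(1)] x(2) by (auto simp: card_1_singleton_iff)
    then show False
      using w x orbit_eq_singleton_iff unfolding nontrivial_orbits_def by blast
  qed
  then show ?thesis
    using i by simp
qed

lemma p_group_card_fixed_points_cong:
  assumes "Factorial_Ring.prime p" and "order G = p ^ n" and fin: "finite E"
  shows "[card E = card (fixed_points G E \<phi>)] (mod p)"
proof -
  have "p dvd (\<Sum>w\<in>nontrivial_orbits G E \<phi>. card w)"
    using p_group_dvd_card_nontrivial_orbit[OF assms(1,2)] by (rule dvd_sum)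
  then show ?thesis
    unfolding card_eq_fixed_points[OF fin]
    by (simp add: cong_def mod_eq_0_iff_dvd flip: mod_add_right_eq)
qed

lemma p_group_card_orbits_le:
  assumes p: "Factorial_Ring.prime p" and ord: "order G = p ^ n" and fin: "finite E"
  shows "p * card (orbits G E \<phi>) + card (fixed_points G E \<phi>)
    \<le> card E + p * card (fixed_points G E \<phi>)"
proof -
  have "p \<le> card w" if w: "w \<in> nontrivial_orbits G E \<phi>" for w
  proof (rule dvd_imp_le[OF p_group_dvd_card_nontrivial_orbit[OF p ord w]])
    have orbit: "w \<in> orbits G E \<phi>"
      using w by (simp add: nontrivial_orbits_def)
    then obtain x where "x \<in> E" "w = orbit G \<phi> x"
      by (auto simp: orbits_def)
    moreover have "finite w"
      using orbit orbits_coverture fin by (metis Union_upper finite_subset)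
    ultimately show "0 < card w"
      using orbit_refl card_gt_0_iff by blast
  qed
  then have "card (nontrivial_orbits G E \<phi>) * p \<le> (\<Sum>w\<in>nontrivial_orbits G E \<phi>. card w)"
    using sum_bounded_below[of "nontrivial_orbits G E \<phi>" p card] by simp
  then show ?thesis
    using card_orbits_eq_fixed_points[OF fin] card_eq_fixed_points[OF fin]
    by (simp add: algebra_simps)
qed

end

section \<open>Orbits under conjugation by a subgroup\<close>

definition conj_orbit :: "('a, 'b) monoid_scheme \<Rightarrow> 'a set \<Rightarrow> 'a \<Rightarrow> 'a set" where
  "conj_orbit G H x = (\<lambda>g. g \<otimes>\<^bsub>G\<^esub> x \<otimes>\<^bsub>G\<^esub> inv\<^bsub>G\<^esub> g) ` H"

definition num_conj_orbits :: "('a, 'b) monoid_scheme \<Rightarrow> 'a set \<Rightarrow> 'a set \<Rightarrow> nat" where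
  "num_conj_orbits G H A = card (conj_orbit G H ` A)"

lemma conj_class_eq_conj_orbit: "conj_class G = conj_orbit G (carrier G)"
  by (auto simp: conj_class_def conj_orbit_def fun_eq_iff)

lemma num_conj_orbits_le_card: "finite A \<Longrightarrow> num_conj_orbits G H A \<le> card A"
  unfolding num_conj_orbits_def by (rule card_image_le)

lemma num_conj_orbits_mono:
  "\<lbrakk>A \<subseteq> B; finite B\<rbrakk> \<Longrightarrow> num_conj_orbits G H A \<le> num_conj_orbits G H B"
  unfolding num_conj_orbits_def by (intro card_mono image_mono finite_imageI)

lemma (in group_hom) image_conj_orbit:
  assumes "K \<subseteq> carrier G" and "x \<in> carrier G"
  shows "h ` conj_orbit G K x = conj_orbit H (h ` K) (h x)"
proof -
  have "h (g \<otimes> x \<otimes> inv g) = h g \<otimes>\<^bsub>H\<^esub> h x \<otimes>\<^bsub>H\<^esub> inv\<^bsub>H\<^esub> h g" if "g \<in> K" for g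
    using assms that by (simp add: subset_iff)
  then show ?thesis
    unfolding conj_orbit_def image_image by (intro image_cong) simp_all
qed

context group
begin

definition centralizer :: "'a set \<Rightarrow> 'a set" where
  "centralizer S = {g \<in> carrier G. \<forall>x\<in>S. g \<otimes> x = x \<otimes> g}"

lemma conj_conj:
  assumes "g \<in> carrier G" and "h \<in> carrier G" and "x \<in> carrier G"
  shows "g \<otimes> (h \<otimes> x \<otimes> inv h) \<otimes> inv g = (g \<otimes> h) \<otimes> x \<otimes> inv (g \<otimes> h)"
  using assms by (simp add: m_assoc inv_mult_group)

lemma conj_eq_iff:
  assumes "g \<in> carrier G" and "x \<in> carrier G" and "y \<in> carrier G"
  shows "g \<otimes> x \<otimes> inv g = y \<longleftrightarrow> g \<otimes> x = y \<otimes> g"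
  using inv_solve_right[of y "g \<otimes> x" g] assms by auto

lemma conj_pow:
  assumes "g \<in> carrier G" and "x \<in> carrier G"
  shows "(g \<otimes> x \<otimes> inv g) [^] (n::nat) = g \<otimes> x [^] n \<otimes> inv g"
proof (induction n)
  case (Suc n)
  have "(g \<otimes> x \<otimes> inv g) [^] Suc n = g \<otimes> x [^] n \<otimes> (inv g \<otimes> g) \<otimes> x \<otimes> inv g"
    unfolding nat_pow_Suc Suc.IH using assms
    by (simp only: m_assoc m_closed inv_closed nat_pow_closed)
  then show ?case
    using assms by (simp add: m_assoc)
qed (use assms in simp)

lemma conjugation_action:
  assumes H: "subgroup H G" and A: "A \<subseteq> carrier G"
    and closed: "\<And>g x. \<lbrakk>g \<in> H; x \<in> A\<rbrakk> \<Longrightarrow> g \<otimes> x \<otimes> inv g \<in> A"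
  shows "group_action (G\<lparr>carrier := H\<rparr>) A (\<lambda>g. \<lambda>x\<in>A. g \<otimes> x \<otimes> inv g)"
proof -
  interpret H: subgroup H G by (rule H)
  let ?c = "\<lambda>g. \<lambda>x\<in>A. g \<otimes> x \<otimes> inv g"
  have "?c (g \<otimes> h) = compose A (?c g) (?c h)" if "g \<in> H" "h \<in> H" for g h
  proof
    fix x show "?c (g \<otimes> h) x = compose A (?c g) (?c h) x"
      using that closed A conj_conj[of g h x] by (auto simp: compose_def)
  qed
  moreover have "?c g \<in> Bij A" if g: "g \<in> H" for g
  proof -
    have inverse: "inv h \<otimes> (h \<otimes> x \<otimes> inv h) \<otimes> inv (inv h) = x" if "h \<in> H" "x \<in> A" for h x
      using that A conj_conj[of "inv h" h x] by auto
    have "bij_betw (?c g) A A"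
      using g closed inverse[of g] inverse[of "inv g"] closed[of "inv g"]
      by (intro bij_betw_byWitness[where f' = "?c (inv g)"]) auto
    then show ?thesis
      by (simp add: Bij_def)
  qed
  ultimately have "?c \<in> hom (G\<lparr>carrier := H\<rparr>) (BijGroup A)"
    by (simp add: hom_def BijGroup_def)
  then show ?thesis
    unfolding group_action_def group_hom_def group_hom_axioms_def
    using subgroup_imp_group[OF H] group_BijGroup by blast
qed

lemma orbit_conjugation:
  assumes "x \<in> A"
  shows "orbit (G\<lparr>carrier := H\<rparr>) (\<lambda>g. \<lambda>x\<in>A. g \<otimes> x \<otimes> inv g) x = conj_orbit G H x"
  using assms by (auto simp: orbit_def conj_orbit_def)

lemma orbits_conjugation:
  "orbits (G\<lparr>carrier := H\<rparr>) A (\<lambda>g. \<lambda>x\<in>A. g \<otimes> x \<otimes> inv g) = conj_orbit G H ` A"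
proof -
  have "orbits (G\<lparr>carrier := H\<rparr>) A \<phi> = orbit (G\<lparr>carrier := H\<rparr>) \<phi> ` A" for \<phi>
    by (auto simp: orbits_def)
  then show ?thesis
    using orbit_conjugation by (metis (no_types, lifting) image_cong)
qed

lemma conj_orbit_eqI:
  assumes H: "subgroup H G" and x: "x \<in> carrier G" and y: "y \<in> conj_orbit G H x"
  shows "conj_orbit G H y = conj_orbit G H x"
proof -
  interpret conj: group_action "G\<lparr>carrier := H\<rparr>" "carrier G" "\<lambda>g. \<lambda>x\<in>carrier G. g \<otimes> x \<otimes> inv g"
    by (rule conjugation_action[OF H]) (use subgroup.subset[OF H] in auto)
  have "y \<in> carrier G"
    using x y subgroup.subset[OF H] by (auto simp: conj_orbit_def)
  then show ?thesis
    using conj.orbit_eqI[OF x, of y] y by (simp only: orbit_conjugation x)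
qed

lemma conj_orbit_refl:
  assumes "subgroup H G" and "x \<in> carrier G"
  shows "x \<in> conj_orbit G H x"
  using assms subgroup.one_closed[OF assms(1)] unfolding conj_orbit_def
  by (intro image_eqI[of _ _ \<one>]) auto

lemma num_conj_orbits_antimono:
  assumes H: "subgroup H G" and K: "subgroup K G" and "H \<subseteq> K"
    and A: "A \<subseteq> carrier G" "finite A"
  shows "num_conj_orbits G K A \<le> num_conj_orbits G H A"
proof -
  have "conj_orbit G K x = (\<Union>y\<in>conj_orbit G H x. conj_orbit G K y)" if x: "x \<in> A" for x
  proof -
    have "conj_orbit G H x \<subseteq> conj_orbit G K x"
      using \<open>H \<subseteq> K\<close> by (auto simp: conj_orbit_def)
    then have "conj_orbit G K y = conj_orbit G K x" if "y \<in> conj_orbit G H x" for y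
      using conj_orbit_eqI[OF K, of x y] that x A(1) by blast
    then show ?thesis
      using conj_orbit_refl[OF H, of x] x A(1) by blast
  qed
  then have "conj_orbit G K ` A = (\<lambda>w. \<Union>y\<in>w. conj_orbit G K y) ` conj_orbit G H ` A"
    unfolding image_image by (rule image_cong[OF refl])
  then show ?thesis
    unfolding num_conj_orbits_def using A(2) by (metis card_image_le finite_imageI)
qed

lemma num_conj_orbits_mult_card:
  assumes fin: "finite (carrier G)" and H: "subgroup H G" and A: "A \<subseteq> carrier G"
    and closed: "\<And>g x. \<lbrakk>g \<in> H; x \<in> A\<rbrakk> \<Longrightarrow> g \<otimes> x \<otimes> inv g \<in> A"
  shows "num_conj_orbits G H A * card H = (\<Sum>x\<in>A. card (H \<inter> centralizer {x}))"
proof -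
  let ?c = "\<lambda>g. \<lambda>x\<in>A. g \<otimes> x \<otimes> inv g"
  interpret conj: group_action "G\<lparr>carrier := H\<rparr>" A ?c
    by (rule conjugation_action[OF H A closed])
  have "stabilizer (G\<lparr>carrier := H\<rparr>) ?c x = H \<inter> centralizer {x}" if x: "x \<in> A" for x
  proof -
    have "g \<otimes> x \<otimes> inv g = x \<longleftrightarrow> g \<in> centralizer {x}" if "g \<in> H" for g
      using that x A subgroup.subset[OF H] conj_eq_iff[of g x x] by (auto simp: centralizer_def)
    then show ?thesis
      using x by (auto simp: stabilizer_def)
  qed
  then show ?thesis
    using conj.card_orbits_mult_order finite_subset[OF A fin]
      finite_subset[OF subgroup.subset[OF H] fin]
    by (simp add: orbits_conjugation num_conj_orbits_def order_def)
qed

end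

section \<open>Elements of order dividing a given number\<close>

lemma coprime_idempotents_mod_nat:
  fixes m q :: nat
  assumes "coprime m q"
  obtains e f where "q dvd e" "m dvd f" "[e = 1] (mod m)" "[e + f = 1] (mod m * q)"
proof -
  obtain e where e: "[e = 1] (mod m)" "[e = 0] (mod q)"
    using binary_chinese_remainder_nat[OF assms] by blast
  obtain f where f: "[f = 0] (mod m)" "[f = 1] (mod q)"
    using binary_chinese_remainder_nat[OF assms] by blast
  have "[e + f = 1] (mod m * q)"
    using cong_add[OF e(1) f(1)] cong_add[OF e(2) f(2)] assms by (simp add: coprime_cong_mult_nat)
  with e f show thesis
    using that by (simp add: cong_0_iff)
qed

context group
begin

definition torsion :: "nat \<Rightarrow> 'a set" where
  "torsion n = {x \<in> carrier G. x [^] n = \<one>}"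

lemma torsion_pow_eq_one:
  assumes "x \<in> torsion n" and "n dvd k"
  shows "x [^] k = \<one>"
  using assms pow_eq_id[of x] dvd_trans[of "ord x" n k] by (simp add: torsion_def)

lemma torsion_pow_cong:
  fixes i j n :: nat
  assumes "x \<in> torsion n" and "[i = j] (mod n)"
  shows "x [^] i = x [^] j"
proof -
  have x: "x \<in> carrier G" "ord x dvd n"
    using assms(1) pow_eq_id by (auto simp: torsion_def)
  have "[int j = int i] (mod int (ord x))"
    using cong_dvd_modulus_nat[OF cong_sym[OF assms(2)] x(2)] by (simp add: cong_int_iff)
  then have "int (ord x) dvd int j - int i"
    by (simp add: cong_iff_dvd_diff)
  then show ?thesis
    using int_pow_eq[OF x(1), of "int i" "int j"] by (simp add: int_pow_int)
qed

lemma torsion_Int_coprime: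
  assumes "coprime m n"
  shows "torsion m \<inter> torsion n = {\<one>}"
proof (intro equalityI subsetI)
  fix x assume "x \<in> torsion m \<inter> torsion n"
  then have x: "x \<in> carrier G" "ord x dvd m" "ord x dvd n"
    using pow_eq_id by (auto simp: torsion_def)
  then have "ord x = 1"
    using assms by (metis coprime_common_divisor nat_dvd_1_iff_1)
  then show "x \<in> {\<one>}"
    using x(1) ord_eq_1 by simp
qed (simp add: torsion_def)

lemma torsion_conj_closed:
  assumes "x \<in> torsion n" and "g \<in> carrier G"
  shows "g \<otimes> x \<otimes> inv g \<in> torsion n"
  using assms conj_pow[of g x n] by (simp add: torsion_def)

lemma subgroup_nat_pow_closed:
  assumes "subgroup H G" and "x \<in> H"
  shows "x [^] (n::nat) \<in> H"
  using subgroup_int_pow_closed[OF assms, of "int n"] by (simp add: int_pow_int)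

lemma subgroup_subset_torsion:
  assumes "subgroup H G"
  shows "H \<subseteq> torsion (card H)"
proof
  fix x assume x: "x \<in> H"
  interpret H: group "G\<lparr>carrier := H\<rparr>"
    using assms by (rule subgroup_imp_group)
  show "x \<in> torsion (card H)"
    using H.pow_order_eq_1[of x] x subgroup.subset[OF assms]
    by (auto simp: torsion_def order_def simp flip: nat_pow_consistent)
qed

section \<open>Orbits of a normal subgroup in one of its cosets\<close>

lemma centralizer_subgroup:
  assumes "S \<subseteq> carrier G"
  shows "subgroup (centralizer S) G"
proof -
  let ?Stab = "stabilizer G (\<lambda>g. \<lambda>h\<in>carrier G. g \<otimes> h \<otimes> inv g)"
  have "centralizer S = \<Inter> (insert (carrier G) (?Stab ` S))"
    using assms by (auto simp: centralizer_def stabilizer_def conj_eq_iff subset_iff)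
  moreover have "subgroup (?Stab x) G" if "x \<in> S" for x
    using that assms group_action.stabilizer_subgroup[OF action_by_conjugation] by blast
  ultimately show ?thesis
    using subgroups_Inter[of "insert (carrier G) (?Stab ` S)"] subgroup_self by auto
qed

lemma card_rcoset_Int_subgroup_le:
  assumes fin: "finite H" and H: "subgroup H G" and K: "subgroup K G" and C: "C \<in> rcosets H"
  shows "card (C \<inter> K) \<le> card (H \<inter> K)"
proof (cases "C \<inter> K = {}")
  case False
  then obtain w where w: "w \<in> C" "w \<in> K"
    by blast
  have wG: "w \<in> carrier G"
    using w(2) subgroup.subset[OF K] by blast
  have CG: "C \<subseteq> carrier G"
    using C rcosets_part_G[OF H] by blast
  show ?thesis
  proof (rule card_inj_on_le)
    show "inj_on (\<lambda>z. z \<otimes> inv w) (C \<inter> K)"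
      using inj_on_multc[OF inv_closed[OF wG]] by (rule inj_on_subset) (use CG in blast)
    have "z \<otimes> inv w \<in> H" if "z \<in> C" for z
      using diff_neutralizes[OF H C that w(1)] .
    then show "(\<lambda>z. z \<otimes> inv w) ` (C \<inter> K) \<subseteq> H \<inter> K"
      using w(2) by (auto simp: subgroup.m_closed[OF K] subgroup.m_inv_closed[OF K])
  qed (use fin in simp)
qed simp

lemma rcoset_eq_of_mem:
  assumes "subgroup H G" and "C \<in> rcosets H" and "x \<in> C"
  shows "C = H #> x"
  using assms repr_independence by (auto simp: RCOSETS_def)

lemma rcoset_conj_closed:
  assumes N: "N \<lhd> G" and C: "C \<in> rcosets N" and g: "g \<in> N" and x: "x \<in> C"
  shows "g \<otimes> x \<otimes> inv g \<in> C"
proof -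
  interpret N: normal N G by (rule N)
  have xG: "x \<in> carrier G"
    using C x rcosets_part_G[OF N.subgroup_axioms] by blast
  have C_eq: "C = N #> x"
    by (rule rcoset_eq_of_mem[OF N.subgroup_axioms C x])
  have "g \<otimes> (x \<otimes> inv g \<otimes> inv x) \<in> N"
    using g xG by (simp add: N.inv_op_closed2)
  moreover have "g \<otimes> x \<otimes> inv g = g \<otimes> (x \<otimes> inv g \<otimes> inv x) \<otimes> x"
    using g xG by (simp add: m_assoc)
  ultimately show ?thesis
    unfolding C_eq r_coset_def by blast
qed

lemma num_conj_orbits_rcoset_torsion_mult_card:
  assumes fin: "finite (carrier G)" and N: "N \<lhd> G" and C: "C \<in> rcosets N"
  shows "num_conj_orbits G N (C \<inter> torsion m) * card N
    = card (SIGMA y:C \<inter> torsion m. N \<inter> centralizer {y})"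
proof -
  have sub: "subgroup N G"
    using N by (rule normal_imp_subgroup)
  have "num_conj_orbits G N (C \<inter> torsion m) * card N
      = (\<Sum>y\<in>C \<inter> torsion m. card (N \<inter> centralizer {y}))"
  proof (rule num_conj_orbits_mult_card[OF fin sub])
    show "g \<otimes> x \<otimes> inv g \<in> C \<inter> torsion m" if "g \<in> N" "x \<in> C \<inter> torsion m" for g x
      using that rcoset_conj_closed[OF N C] torsion_conj_closed subgroup.mem_carrier[OF sub] by auto
  qed (auto simp: torsion_def)
  moreover have "finite (C \<inter> torsion m)" "finite N"
    using fin finite_subset subgroup.subset[OF sub] by (auto simp: torsion_def)
  ultimately show ?thesis
    by (simp add: card_SigmaI)
qed

lemma coprime_torsion_decomposition:
  assumes ord: "order G = m * q" and cop: "coprime m q"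
  obtains e f :: nat
    where "\<And>x. x \<in> carrier G \<Longrightarrow> x [^] e \<otimes> x [^] f = x"
      and "\<And>x. x \<in> carrier G \<Longrightarrow> x [^] e \<in> torsion m"
      and "\<And>x. x \<in> carrier G \<Longrightarrow> x [^] (f * e) = \<one>"
      and "\<And>x. x \<in> torsion m \<Longrightarrow> x [^] e = x"
proof -
  obtain e f where ef: "q dvd e" "m dvd f" "[e = 1] (mod m)" "[e + f = 1] (mod m * q)"
    using coprime_idempotents_mod_nat[OF cop] by blast
  have exponent: "x \<in> torsion (m * q)" if "x \<in> carrier G" for x
    using that pow_order_eq_1 ord by (simp add: torsion_def)
  show thesis
  proof
    show "x [^] e \<otimes> x [^] f = x" if "x \<in> carrier G" for x
      using torsion_pow_cong[OF exponent[OF that] ef(4)] that by (simp add: nat_pow_mult)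
    show "x [^] e \<in> torsion m" if "x \<in> carrier G" for x
      using torsion_pow_eq_one[OF exponent[OF that], of "e * m"] ef(1) that
      by (simp add: torsion_def nat_pow_pow mult.commute[of m])
    show "x [^] (f * e) = \<one>" if "x \<in> carrier G" for x
      using torsion_pow_eq_one[OF exponent[OF that]] ef(1,2) by (simp add: mult_dvd_mono)
    show "x [^] e = x" if "x \<in> torsion m" for x
      using torsion_pow_cong[OF that ef(3)] that by (simp add: torsion_def)
  qed
qed

lemma mult_pow_mem_centralizer_pow:
  assumes "y \<in> carrier G" and "c \<in> centralizer {y}"
  shows "y \<otimes> c [^] (i::nat) \<in> centralizer {c [^] (j::nat)}"
proof -
  have c: "c \<in> carrier G" and comm: "c [^] j \<otimes> y = y \<otimes> c [^] j"
    using assms by (simp_all add: centralizer_def group_commutes_pow)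
  have "y \<otimes> c [^] i \<otimes> c [^] j = y \<otimes> c [^] j \<otimes> c [^] i"
    using assms(1) c by (simp add: m_assoc nat_pow_mult add.commute)
  also have "\<dots> = c [^] j \<otimes> (y \<otimes> c [^] i)"
    using assms(1) c by (simp add: m_assoc flip: comm)
  finally show ?thesis
    using assms(1) c by (simp add: centralizer_def)
qed

text \<open>Moving the factor \<open>c [^] f\<close> of \<open>c = c [^] e \<otimes> c [^] f\<close> over to \<open>y\<close> turns a commuting pair
  \<open>(y, c)\<close> into another one, from which it can be recovered.\<close>
lemma inj_on_commuting_pair_shift:
  fixes e f m :: nat
  assumes split: "\<And>x. x \<in> carrier G \<Longrightarrow> x [^] e \<otimes> x [^] f = x"
    and annihilate: "\<And>x. x \<in> carrier G \<Longrightarrow> x [^] (f * e) = \<one>"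
    and fix_torsion: "\<And>x. x \<in> torsion m \<Longrightarrow> x [^] e = x"
  shows "inj_on (\<lambda>(y, c). (c [^] e, y \<otimes> c [^] f)) (SIGMA y:torsion m. centralizer {y})"
proof (rule inj_onI, clarify)
  have recover: "(y \<otimes> c [^] f) [^] e = y" if y: "y \<in> torsion m" and c: "c \<in> centralizer {y}" for y c
  proof -
    have G: "y \<in> carrier G" "c \<in> carrier G" and "c [^] f \<otimes> y = y \<otimes> c [^] f"
      using y c by (simp_all add: torsion_def centralizer_def group_commutes_pow)
    then have "(y \<otimes> c [^] f) [^] e = y [^] e \<otimes> c [^] (f * e)"
      by (simp add: pow_mult_distrib nat_pow_pow)
    then show ?thesis
      using fix_torsion[OF y] annihilate[OF G(2)] G(1) by simp
  qed
  fix y c y' c'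
  assume y: "y \<in> torsion m" "y' \<in> torsion m" and c: "c \<in> centralizer {y}" "c' \<in> centralizer {y'}"
    and eq: "c [^] e = c' [^] e" "y \<otimes> c [^] f = y' \<otimes> c' [^] f"
  have G: "y \<in> carrier G" "c \<in> carrier G" "c' \<in> carrier G"
    using y c by (simp_all add: torsion_def centralizer_def)
  have "y = y'"
    using recover[OF y(1) c(1)] recover[OF y(2) c(2)] eq(2) by simp
  moreover from this have "c [^] f = c' [^] f"
    using eq(2) G by simp
  then have "c = c'"
    using split[OF G(2)] split[OF G(3)] eq(1) by metis
  ultimately show "y = y' \<and> c = c'" ..
qed

lemma card_commuting_pairs_rcoset_le:
  assumes fin: "finite (carrier G)" and ord: "order G = m * q" and cop: "coprime m q"
    and N: "N \<lhd> G" and C: "C \<in> rcosets N"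
  shows "card (SIGMA y:C \<inter> torsion m. N \<inter> centralizer {y})
    \<le> card (SIGMA s:N \<inter> torsion m. C \<inter> centralizer {s})" (is "card ?A \<le> card ?B")
proof -
  interpret N: normal N G by (rule N)
  have CG: "C \<subseteq> carrier G"
    using C rcosets_part_G[OF N.subgroup_axioms] by blast
  obtain e f :: nat where split: "\<And>c. c \<in> carrier G \<Longrightarrow> c [^] e \<otimes> c [^] f = c"
      and torsion: "\<And>c. c \<in> carrier G \<Longrightarrow> c [^] e \<in> torsion m"
      and annihilate: "\<And>c. c \<in> carrier G \<Longrightarrow> c [^] (f * e) = \<one>"
      and fix_torsion: "\<And>y. y \<in> torsion m \<Longrightarrow> y [^] e = y"
    using coprime_torsion_decomposition[OF ord cop] by blast
  let ?shift = "\<lambda>(y, c). (c [^] e, y \<otimes> c [^] f)"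
  have "inj_on ?shift ?A"
    by (rule inj_on_subset[OF inj_on_commuting_pair_shift[OF split annihilate fix_torsion]]) auto
  moreover have "?shift ` ?A \<subseteq> ?B"
  proof clarify
    fix y c assume y: "y \<in> C" "y \<in> torsion m" and c: "c \<in> N" "c \<in> centralizer {y}"
    have yG: "y \<in> carrier G"
      using y(1) CG by blast
    have pow_N: "c [^] i \<in> N" for i :: nat
      using subgroup_nat_pow_closed[OF N.subgroup_axioms c(1)] .
    have "y \<otimes> c [^] f = c [^] f \<otimes> y"
      using c(2) yG by (simp add: centralizer_def group_commutes_pow)
    moreover have "C = N #> y"
      by (rule rcoset_eq_of_mem[OF N.subgroup_axioms C y(1)])
    ultimately have "y \<otimes> c [^] f \<in> C"
      using pow_N[of f] by (auto simp: r_coset_def)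
    then show "c [^] e \<in> N \<inter> torsion m \<and> y \<otimes> c [^] f \<in> C \<inter> centralizer {c [^] e}"
      using mult_pow_mem_centralizer_pow[OF yG c(2)] pow_N torsion[OF N.mem_carrier[OF c(1)]]
      by simp
  qed
  moreover have "finite ?B"
    using finite_subset[OF CG fin] finite_subset[OF N.subset fin] by (intro finite_SigmaI) auto
  ultimately show ?thesis
    by (rule card_inj_on_le)
qed

lemma num_conj_orbits_rcoset_torsion_le:
  assumes fin: "finite (carrier G)" and "order G = m * q" and "coprime m q"
    and N: "N \<lhd> G" and C: "C \<in> rcosets N"
  shows "num_conj_orbits G N (C \<inter> torsion m) \<le> num_conj_orbits G N (N \<inter> torsion m)"
proof -
  interpret N: normal N G by (rule N)
  have "C \<subseteq> carrier G"
    using C rcosets_part_G[OF N.subgroup_axioms] by blast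
  then have finN: "finite N" and finC: "finite C"
    using N.subset fin by (auto intro: finite_subset)
  have N_coset: "N \<in> rcosets N"
    using N.subgroup_in_rcosets[OF group_axioms] .
  have "num_conj_orbits G N (C \<inter> torsion m) * card N
      = card (SIGMA y:C \<inter> torsion m. N \<inter> centralizer {y})"
    by (rule num_conj_orbits_rcoset_torsion_mult_card[OF fin N C])
  also have "\<dots> \<le> card (SIGMA s:N \<inter> torsion m. C \<inter> centralizer {s})"
    by (rule card_commuting_pairs_rcoset_le[OF assms])
  also have "\<dots> = (\<Sum>s\<in>N \<inter> torsion m. card (C \<inter> centralizer {s}))"
    using finN finC by (simp add: card_SigmaI)
  also have "\<dots> \<le> (\<Sum>s\<in>N \<inter> torsion m. card (N \<inter> centralizer {s}))"
    by (intro sum_mono card_rcoset_Int_subgroup_le[OF finN N.subgroup_axioms _ C]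
        centralizer_subgroup) simp
  also have "\<dots> = card (SIGMA s:N \<inter> torsion m. N \<inter> centralizer {s})"
    using finN by (simp add: card_SigmaI)
  also have "\<dots> = num_conj_orbits G N (N \<inter> torsion m) * card N"
    by (rule num_conj_orbits_rcoset_torsion_mult_card[OF fin N N_coset, symmetric])
  finally show ?thesis
    using N.finite_imp_card_positive[OF fin] by simp
qed

end

section \<open>Coprime action of a \<open>p\<close>-subgroup\<close>

context group
begin

lemma rcosets_subgroup: "rcosets\<^bsub>G\<lparr>carrier := K\<rparr>\<^esub> H = (\<lambda>x. H #> x) ` K"
  by (auto simp: RCOSETS_def)

lemma card_image_rcosets:
  assumes "subgroup H G" and "subgroup K G" and "H \<subseteq> K"
  shows "card ((\<lambda>x. H #> x) ` K) * card H = card K"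
proof -
  interpret K: group "G\<lparr>carrier := K\<rparr>"
    using assms(2) by (rule subgroup_imp_group)
  show ?thesis
    using K.lagrange[OF subgroup_incl[OF assms]] by (simp add: order_def rcosets_subgroup)
qed

lemma card_subgroup_dvd:
  assumes "subgroup H G" and "subgroup K G" and "H \<subseteq> K"
  shows "card H dvd card K"
  using card_image_rcosets[OF assms] by (metis dvd_triv_right)

lemma fixed_points_conjugation:
  assumes P: "subgroup P G" and A: "A \<subseteq> carrier G"
  shows "fixed_points (G\<lparr>carrier := P\<rparr>) A (\<lambda>g. \<lambda>x\<in>A. g \<otimes> x \<otimes> inv g) = A \<inter> centralizer P"
proof -
  have "(\<forall>g\<in>P. g \<otimes> x \<otimes> inv g = x) \<longleftrightarrow> x \<in> centralizer P" if "x \<in> A" for x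
  proof -
    have x: "x \<in> carrier G"
      using that A by blast
    have "g \<otimes> x \<otimes> inv g = x \<longleftrightarrow> x \<otimes> g = g \<otimes> x" if "g \<in> P" for g
      using conj_eq_iff[of g x x] subgroup.mem_carrier[OF P that] x by auto
    then show ?thesis
      using x by (simp add: centralizer_def)
  qed
  then show ?thesis
    by (auto simp: fixed_points_def)
qed

text \<open>The index \<open>t\<close> of the fixed points of \<open>P\<close> satisfies \<open>t * card C = card K\<close>, where \<open>card C\<close> and
  \<open>card K\<close> are congruent and prime to \<open>p\<close>; so \<open>t\<close> is congruent to 1.\<close>
lemma card_coprime_centralizer_le:
  assumes fin: "finite (carrier G)" and p: "Factorial_Ring.prime p"
    and K: "K \<lhd> G" and cop: "coprime (card K) p" and P: "subgroup P G" "card P = p ^ n"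
    and nontrivial: "\<not> K \<subseteq> centralizer P"
  shows "(p + 1) * card (K \<inter> centralizer P) \<le> card K"
proof -
  interpret K: normal K G by (rule K)
  interpret conj: group_action "G\<lparr>carrier := P\<rparr>" K "\<lambda>g. \<lambda>x\<in>K. g \<otimes> x \<otimes> inv g"
    using subgroup.mem_carrier[OF P(1)] by (intro conjugation_action P K.subset K.inv_op_closed2)
  let ?C = "K \<inter> centralizer P"
  have finK: "finite K"
    using finite_subset[OF K.subset fin] .
  have "subgroup ?C G"
    using subgroups_Inter_pair[OF K.subgroup_axioms] centralizer_subgroup subgroup.subset[OF P(1)]
    by blast
  then have "card ?C dvd card K"
    using card_subgroup_dvd[OF _ K.subgroup_axioms] by simp
  then obtain t where t: "card K = t * card ?C"
    by (metis dvdE mult.commute)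
  have "[card K = card ?C] (mod p)"
    using conj.p_group_card_fixed_points_cong[OF p _ finK] P(2)
    by (simp add: order_def fixed_points_conjugation[OF P(1) K.subset])
  then have "[t * card ?C = 1 * card ?C] (mod p)"
    by (simp add: t)
  moreover have "coprime (card ?C) p"
    using cop by (simp add: t)
  ultimately have "p dvd t - 1"
    using cong_mult_rcancel_nat cong_to_1_nat by blast
  moreover have "t > 0"
    using K.finite_imp_card_positive[OF fin] t by (cases t) simp_all
  moreover have "t \<noteq> 1"
  proof
    assume "t = 1"
    then have "?C = K"
      using t finK by (intro card_subset_eq) simp_all
    then show False
      using nontrivial by blast
  qed
  ultimately have "p \<le> t - 1"
    by (intro dvd_imp_le) simp_all
  with \<open>t > 0\<close> have "p + 1 \<le> t"
    by linarith
  then show ?thesis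
    unfolding t by (rule mult_le_mono1)
qed

lemma num_conj_orbits_coprime_p_subgroup_le:
  assumes fin: "finite (carrier G)" and p: "Factorial_Ring.prime p"
    and K: "K \<lhd> G" and "coprime (card K) p" and P: "subgroup P G" "card P = p ^ n"
    and "\<not> K \<subseteq> centralizer P"
  shows "(p + 1) * num_conj_orbits G P K \<le> 2 * card K"
proof -
  interpret K: normal K G by (rule K)
  interpret conj: group_action "G\<lparr>carrier := P\<rparr>" K "\<lambda>g. \<lambda>x\<in>K. g \<otimes> x \<otimes> inv g"
    using subgroup.mem_carrier[OF P(1)] by (intro conjugation_action P K.subset K.inv_op_closed2)
  let ?c = "card (K \<inter> centralizer P)"
  obtain q where q: "p = Suc q"
    using p prime_gt_0_nat gr0_conv_Suc by blast
  have index: "(p + 1) * ?c \<le> card K"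
    by (rule card_coprime_centralizer_le[OF assms])
  have "p * num_conj_orbits G P K + ?c \<le> card K + p * ?c"
    using conj.p_group_card_orbits_le[OF p _ finite_subset[OF K.subset fin], of n] P(2)
    by (simp add: order_def num_conj_orbits_def orbits_conjugation
        fixed_points_conjugation[OF P(1) K.subset])
  then have "p * num_conj_orbits G P K \<le> card K + q * ?c"
    by (simp add: q)
  then have "p * ((p + 1) * num_conj_orbits G P K) \<le> (p + 1) * (card K + q * ?c)"
    by (metis mult.left_commute mult_le_mono2)
  also have "\<dots> = (p + 1) * card K + q * ((p + 1) * ?c)"
    by (simp add: algebra_simps)
  also have "\<dots> \<le> (p + 1) * card K + q * card K"
    using index by simp
  also have "\<dots> = p * (2 * card K)"
    by (simp add: q)
  finally show ?thesis
    unfolding q by (metis mult_le_cancel1 zero_less_Suc)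
qed

lemma torsion_card_eq_commuting_complement:
  assumes fin: "finite (carrier G)" and P: "subgroup P G" and K: "subgroup K G"
    and ord: "order G = card P * card K" and cop: "coprime (card P) (card K)"
    and commute: "K \<subseteq> centralizer P"
  shows "torsion (card P) = P"
proof
  interpret group_disjoint_sum G P K
    using P K by (intro group_disjoint_sum.intro group_axioms)
  let ?h = "\<lambda>(u, k). u \<otimes> k"
  have "P \<inter> K \<subseteq> {\<one>}"
    using subgroup_subset_torsion[OF P] subgroup_subset_torsion[OF K] torsion_Int_coprime[OF cop]
    by blast
  then have "inj_on ?h (P \<times> K)"
    unfolding cancel by (auto simp: inj_on_def)
  then have "card (?h ` (P \<times> K)) = card (carrier G)"
    by (simp add: card_image card_cartesian_product ord[unfolded order_def])
  moreover have "?h ` (P \<times> K) \<subseteq> carrier G"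
    by auto
  ultimately have product: "?h ` (P \<times> K) = carrier G"
    using fin by (simp add: card_subset_eq)
  show "torsion (card P) \<subseteq> P"
  proof
    fix y assume y: "y \<in> torsion (card P)"
    then have "y \<in> carrier G"
      by (simp add: torsion_def)
    then obtain u k where uk: "u \<in> P" "k \<in> K" "y = u \<otimes> k"
      unfolding product[symmetric] by auto
    have "\<one> = u [^] card P \<otimes> k [^] card P"
      using y uk commute by (auto simp: torsion_def centralizer_def pow_mult_distrib subset_iff)
    also have "u [^] card P = \<one>"
      using subgroup_subset_torsion[OF P] uk(1) by (auto simp: torsion_def)
    finally have "k \<in> torsion (card P) \<inter> torsion (card K)"
      using uk(2) subgroup_subset_torsion[OF K] by (auto simp: torsion_def)
    then show "y \<in> P"
      using uk torsion_Int_coprime[OF cop] by simp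
  qed
qed (rule subgroup_subset_torsion[OF P])

lemma num_conj_orbits_le_or_torsion_subgroup:
  assumes fin: "finite (carrier G)" and p: "Factorial_Ring.prime p"
    and K: "K \<lhd> G" and cop: "coprime (card K) p" and ord: "order G = p ^ n * card K"
  shows "(p + 1) * num_conj_orbits G (carrier G) K \<le> 2 * card K
    \<or> subgroup (torsion (p ^ n)) G \<and> card (torsion (p ^ n)) = p ^ n"
proof -
  interpret K: normal K G by (rule K)
  obtain P where P: "subgroup P G" "card P = p ^ n"
    using sylow_thm[OF p group_axioms ord fin] by blast
  show ?thesis
  proof (cases "K \<subseteq> centralizer P")
    case True
    then have "torsion (p ^ n) = P"
      using torsion_card_eq_commuting_complement[OF fin P(1) K.subgroup_axioms] ord cop P(2)
      by (simp add: coprime_commute)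
    then show ?thesis
      using P by simp
  next
    case False
    have "num_conj_orbits G (carrier G) K \<le> num_conj_orbits G P K"
      using num_conj_orbits_antimono[OF P(1) subgroup_self subgroup.subset[OF P(1)] K.subset]
        finite_subset[OF K.subset fin] .
    then have "(p + 1) * num_conj_orbits G (carrier G) K \<le> (p + 1) * num_conj_orbits G P K"
      by (rule mult_le_mono2)
    also have "\<dots> \<le> 2 * card K"
      by (rule num_conj_orbits_coprime_p_subgroup_le[OF fin p K cop P False])
    finally show ?thesis ..
  qed
qed

end

section \<open>Classes of \<open>p'\<close>-elements in extensions\<close>

definition p'_part :: "nat \<Rightarrow> nat \<Rightarrow> nat" where
  "p'_part p n = n div p ^ multiplicity p n"

lemma power_multiplicity_mult_p'_part: "n = p ^ multiplicity p n * p'_part p n"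
  by (simp add: p'_part_def multiplicity_dvd)

lemma p'_part_pos: "n > 0 \<Longrightarrow> p'_part p n > 0"
  using power_multiplicity_mult_p'_part[of n p] by (intro gr0I) simp

lemma coprime_p'_part:
  assumes "Factorial_Ring.prime p" and "n > 0"
  shows "coprime (p'_part p n) p"
proof -
  have "\<not> p dvd p'_part p n"
    using multiplicity_decompose[of n p] prime_gt_1_nat[OF assms(1)] assms(2)
    by (simp add: p'_part_def)
  then show ?thesis
    using assms(1) by (metis coprime_commute prime_imp_coprime)
qed

lemma p'_part_mult:
  assumes "Factorial_Ring.prime p" and "m > 0" and "n > 0"
  shows "p'_part p (m * n) = p'_part p m * p'_part p n"
proof -
  have "multiplicity p (m * n) = multiplicity p m + multiplicity p n"
    using assms by (simp add: prime_elem_multiplicity_mult_distrib)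
  then show ?thesis
    by (simp add: p'_part_def power_add div_mult_div_if_dvd multiplicity_dvd)
qed

lemma p'_part_prime_power: "Factorial_Ring.prime p \<Longrightarrow> p'_part p (p ^ n) = 1"
  using prime_gt_0_nat[of p] by (simp add: p'_part_def)

lemma p'_part_coprime:
  assumes "Factorial_Ring.prime p" and "coprime n p"
  shows "p'_part p n = n"
proof -
  have "\<not> p dvd n"
    using assms by (metis coprime_common_divisor dvd_refl not_prime_unit)
  then show ?thesis
    by (simp add: p'_part_def not_dvd_imp_multiplicity_0)
qed

lemma order_p'_eq_p'_part:
  assumes p: "Factorial_Ring.prime p" and pos: "order G > 0"
  shows "order_p' G p = p'_part p (order G)"
  unfolding order_p'_def
proof (rule Max_eqI)
  show "finite {d. d dvd order G \<and> coprime d p}"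
    using pos by (simp add: finite_divisors_nat)
  show "p'_part p (order G) \<in> {d. d dvd order G \<and> coprime d p}"
    using coprime_p'_part[OF p pos] power_multiplicity_mult_p'_part[of "order G" p]
    by (metis (mono_tags, lifting) dvd_triv_right mem_Collect_eq)
  fix d assume "d \<in> {d. d dvd order G \<and> coprime d p}"
  then have "d dvd p ^ multiplicity p (order G) * p'_part p (order G)" "coprime d p"
    by (simp_all flip: power_multiplicity_mult_p'_part)
  then have "d dvd p'_part p (order G)"
    by (simp add: coprime_dvd_mult_right_iff)
  then show "d \<le> p'_part p (order G)"
    using p'_part_pos[OF pos] by (rule dvd_imp_le)
qed

context group
begin

lemma ord_subgroup:
  assumes "subgroup H G"
  shows "group.ord (G\<lparr>carrier := H\<rparr>) x = ord x"
proof -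
  interpret H: group "G\<lparr>carrier := H\<rparr>"
    using assms by (rule subgroup_imp_group)
  show ?thesis
    unfolding H.ord_def ord_def by (simp flip: nat_pow_consistent)
qed

lemma k_p'_subgroup:
  assumes H: "subgroup H G"
  shows "k_p' (G\<lparr>carrier := H\<rparr>) p = num_conj_orbits G H (H \<inter> p'_elements G p)"
proof -
  have "p'_elements (G\<lparr>carrier := H\<rparr>) p = H \<inter> p'_elements G p"
    using subgroup.subset[OF H] by (auto simp: p'_elements_def ord_subgroup[OF H])
  moreover have "conj_orbit (G\<lparr>carrier := H\<rparr>) H x = conj_orbit G H x" for x
    unfolding conj_orbit_def by (rule image_cong) (use m_inv_consistent[OF H] in simp_all)
  ultimately show ?thesis
    by (simp add: k_p'_def num_conj_orbits_def conj_class_eq_conj_orbit)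
qed

lemma p'_elements_eq_torsion:
  assumes fin: "finite (carrier G)" and p: "Factorial_Ring.prime p"
  shows "p'_elements G p = torsion (p'_part p (order G))"
proof -
  let ?m = "p'_part p (order G)"
  have "\<not> p dvd ord x \<longleftrightarrow> ord x dvd ?m" if x: "x \<in> carrier G" for x
  proof
    assume "\<not> p dvd ord x"
    then have "coprime (ord x) (p ^ multiplicity p (order G))"
      using p by (simp add: coprime_commute prime_imp_coprime)
    moreover have "ord x dvd p ^ multiplicity p (order G) * ?m"
      using ord_dvd_group_order[OF x] by (simp flip: power_multiplicity_mult_p'_part)
    ultimately show "ord x dvd ?m"
      by (simp add: coprime_dvd_mult_right_iff)
  next
    assume "ord x dvd ?m"
    moreover have "coprime ?m p"
      using coprime_p'_part[OF p] fin order_gt_0_iff_finite by simp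
    ultimately show "\<not> p dvd ord x"
      using p by (meson coprime_common_divisor dvd_refl dvd_trans not_prime_unit)
  qed
  then show ?thesis
    unfolding p'_elements_def torsion_def
    by (intro Collect_cong conj_cong refl) (simp add: pow_eq_id)
qed

lemma conj_orbit_meets_rcoset:
  assumes N: "N \<lhd> G" and x: "x \<in> carrier G" and y: "y \<in> carrier G"
    and eq: "conj_orbit (G Mod N) (carrier (G Mod N)) (N #> x)
      = conj_orbit (G Mod N) (carrier (G Mod N)) (N #> y)"
  obtains z where "z \<in> conj_orbit G (carrier G) x" and "z \<in> N #> y"
proof -
  interpret N: normal N G by (rule N)
  interpret quotient: group_hom G "G Mod N" "\<lambda>x. N #> x"
    by (simp add: group_hom_def group_hom_axioms_def N.factorgroup_is_group N.r_coset_hom_Mod)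
  have orbit: "conj_orbit (G Mod N) (carrier (G Mod N)) (N #> z)
      = (\<lambda>z. N #> z) ` conj_orbit G (carrier G) z" if "z \<in> carrier G" for z
    using quotient.image_conj_orbit[of "carrier G" z] that by (simp add: carrier_FactGroup)
  have "N #> y \<in> (\<lambda>z. N #> z) ` conj_orbit G (carrier G) x"
    using eq conj_orbit_refl[OF subgroup_self y] by (simp add: orbit[OF x] orbit[OF y])
  then obtain z where z: "z \<in> conj_orbit G (carrier G) x" "N #> y = N #> z"
    by blast
  moreover have "z \<in> carrier G"
    using z(1) x by (auto simp: conj_orbit_def)
  ultimately show thesis
    using that rcos_self[OF _ N.subgroup_axioms] by metis
qed

lemma num_conj_orbits_le_quotient:
  assumes fin: "finite (carrier G)" and N: "N \<lhd> G" and A: "A \<subseteq> carrier G"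
    and closed: "\<And>g x. \<lbrakk>g \<in> carrier G; x \<in> A\<rbrakk> \<Longrightarrow> g \<otimes> x \<otimes> inv g \<in> A"
    and coset: "\<And>C. C \<in> rcosets N \<Longrightarrow> num_conj_orbits G (carrier G) (C \<inter> A) \<le> b"
  shows "num_conj_orbits G (carrier G) A
    \<le> num_conj_orbits (G Mod N) (carrier (G Mod N)) ((\<lambda>x. N #> x) ` A) * b"
proof -
  let ?orb = "conj_orbit G (carrier G)"
  let ?Q = "\<lambda>x. conj_orbit (G Mod N) (carrier (G Mod N)) (N #> x)"
  have finA: "finite A"
    using finite_subset[OF A fin] .
  have fibre: "?orb x \<in> ?orb ` ((N #> y) \<inter> A)"
    if x: "x \<in> A" and y: "y \<in> A" and eq: "?Q x = ?Q y" for x y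
  proof -
    obtain z where z: "z \<in> ?orb x" "z \<in> N #> y"
      using conj_orbit_meets_rcoset[OF N _ _ eq] x y A by blast
    then have "z \<in> A"
      using closed x by (auto simp: conj_orbit_def)
    moreover have "?orb x = ?orb z"
      using conj_orbit_eqI[OF subgroup_self _ z(1)] x A by auto
    ultimately show ?thesis
      using z(2) by blast
  qed
  have card_fibre: "card (?orb ` {x \<in> A. ?Q x = w}) \<le> b" if w: "w \<in> ?Q ` A" for w
  proof -
    obtain y where y: "y \<in> A" "w = ?Q y"
      using w by blast
    have "card (?orb ` {x \<in> A. ?Q x = w}) \<le> num_conj_orbits G (carrier G) ((N #> y) \<inter> A)"
      unfolding y(2) num_conj_orbits_def using fibre y(1) finA by (intro card_mono) auto
    also have "\<dots> \<le> b"
      using y(1) A normal_imp_subgroup[OF N] by (intro coset rcosetsI subgroup.subset) auto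
    finally show ?thesis .
  qed
  have "num_conj_orbits G (carrier G) A = card (\<Union>w\<in>?Q ` A. ?orb ` {x \<in> A. ?Q x = w})"
    unfolding num_conj_orbits_def by (intro arg_cong[where f = card]) auto
  also have "\<dots> \<le> (\<Sum>w\<in>?Q ` A. card (?orb ` {x \<in> A. ?Q x = w}))"
    using finA by (intro card_UN_le) simp
  also have "\<dots> \<le> card (?Q ` A) * b"
    using sum_bounded_above[of "?Q ` A" _ b] card_fibre by simp
  finally show ?thesis
    by (simp add: num_conj_orbits_def image_image)
qed

lemma k_p'_le_quotient:
  assumes fin: "finite (carrier G)" and p: "Factorial_Ring.prime p" and N: "N \<lhd> G"
  shows "k_p' G p \<le> num_conj_orbits (G Mod N) (carrier (G Mod N)) ((\<lambda>x. N #> x) ` p'_elements G p)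
    * k_p' (G\<lparr>carrier := N\<rparr>) p"
proof -
  interpret N: normal N G by (rule N)
  define m where "m = p'_part p (order G)"
  have ord: "order G = m * p ^ multiplicity p (order G)"
    unfolding m_def by (metis power_multiplicity_mult_p'_part mult.commute)
  have cop: "coprime m (p ^ multiplicity p (order G))"
    using coprime_p'_part[OF p] fin order_gt_0_iff_finite by (simp add: m_def)
  have torsion: "p'_elements G p = torsion m"
    unfolding m_def by (rule p'_elements_eq_torsion[OF fin p])
  have "num_conj_orbits G (carrier G) (C \<inter> torsion m) \<le> num_conj_orbits G N (N \<inter> torsion m)"
    if C: "C \<in> rcosets N" for C
  proof -
    have "C \<inter> torsion m \<subseteq> carrier G"
      by (auto simp: torsion_def)
    then have "num_conj_orbits G (carrier G) (C \<inter> torsion m) \<le> num_conj_orbits G N (C \<inter> torsion m)"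
      using num_conj_orbits_antimono[OF N.subgroup_axioms subgroup_self N.subset] fin finite_subset
      by blast
    also have "\<dots> \<le> num_conj_orbits G N (N \<inter> torsion m)"
      by (rule num_conj_orbits_rcoset_torsion_le[OF fin ord cop N C])
    finally show ?thesis .
  qed
  then have "num_conj_orbits G (carrier G) (torsion m)
      \<le> num_conj_orbits (G Mod N) (carrier (G Mod N)) ((\<lambda>x. N #> x) ` torsion m)
        * num_conj_orbits G N (N \<inter> torsion m)"
    using torsion_conj_closed
    by (intro num_conj_orbits_le_quotient[OF fin N]) (auto simp: torsion_def)
  then show ?thesis
    by (simp add: k_p'_subgroup[OF N.subgroup_axioms] torsion)
      (simp add: k_p'_def num_conj_orbits_def conj_class_eq_conj_orbit torsion)
qed

lemma order_FactGroup:
  assumes "finite (carrier G)" and "N \<lhd> G" and "order G = c * card N"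
  shows "order (G Mod N) = c"
proof -
  interpret N: normal N G by (rule assms(2))
  have "order (G Mod N) * card N = c * card N"
    using card_image_rcosets[OF N.subgroup_axioms subgroup_self N.subset] assms(3)
    by (simp add: order_def carrier_FactGroup)
  then show ?thesis
    using N.finite_imp_card_positive[OF assms(1)] by simp
qed

lemma k_p'_le_index_mult:
  assumes fin: "finite (carrier G)" and p: "Factorial_Ring.prime p" and N: "N \<lhd> G"
    and ord: "order G = c * card N"
  shows "k_p' G p \<le> c * k_p' (G\<lparr>carrier := N\<rparr>) p"
proof -
  have finQ: "finite (carrier (G Mod N))"
    using fin by (simp add: carrier_FactGroup)
  have "num_conj_orbits (G Mod N) (carrier (G Mod N)) ((\<lambda>x. N #> x) ` p'_elements G p)
      \<le> num_conj_orbits (G Mod N) (carrier (G Mod N)) (carrier (G Mod N))"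
    using finQ by (intro num_conj_orbits_mono) (auto simp: carrier_FactGroup p'_elements_def)
  also have "\<dots> \<le> c"
    using num_conj_orbits_le_card[OF finQ] order_FactGroup[OF fin N ord] by (simp add: order_def)
  finally show ?thesis
    using k_p'_le_quotient[OF fin p N] by (meson le_trans mult_le_mono1)
qed

lemma p'_elements_subset_normal:
  assumes fin: "finite (carrier G)" and p: "Factorial_Ring.prime p" and N: "N \<lhd> G"
    and ord: "order G = p ^ n * card N"
  shows "p'_elements G p \<subseteq> N"
proof
  fix x assume x: "x \<in> p'_elements G p"
  interpret N: normal N G by (rule N)
  interpret Q: group "G Mod N" by (rule N.factorgroup_is_group)
  have xG: "x \<in> carrier G"
    using x by (simp add: p'_elements_def)
  have xQ: "N #> x \<in> carrier (G Mod N)"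
    using xG by (simp add: carrier_FactGroup)
  have "N #> x \<in> Q.torsion (p ^ n)"
    using Q.pow_order_eq_1[OF xQ] xQ order_FactGroup[OF fin N ord] by (simp add: Q.torsion_def)
  moreover have "N #> x \<in> Q.torsion (ord x)"
    using N.FactGroup_pow[OF xG, of "ord x"] xQ xG N.subset by (simp add: Q.torsion_def)
  moreover have "coprime (p ^ n) (ord x)"
    using x p by (simp add: p'_elements_def prime_imp_coprime)
  ultimately have "N #> x = N"
    using Q.torsion_Int_coprime by (metis Int_iff one_FactGroup singletonD)
  then show "x \<in> N"
    using rcos_self[OF xG N.subgroup_axioms] by simp
qed

lemma k_p'_le_normal_of_p_index:
  assumes fin: "finite (carrier G)" and p: "Factorial_Ring.prime p" and N: "N \<lhd> G"
    and "order G = p ^ n * card N"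
  shows "k_p' G p \<le> k_p' (G\<lparr>carrier := N\<rparr>) p"
proof -
  interpret N: normal N G by (rule N)
  have "(\<lambda>x. N #> x) ` p'_elements G p \<subseteq> {N}"
    using p'_elements_subset_normal[OF assms] N.rcos_const by blast
  then have one_orbit:
    "num_conj_orbits (G Mod N) (carrier (G Mod N)) ((\<lambda>x. N #> x) ` p'_elements G p) \<le> 1"
    using le_trans[OF num_conj_orbits_mono num_conj_orbits_le_card] by fastforce
  show ?thesis
    using le_trans[OF k_p'_le_quotient[OF fin p N] mult_le_mono1[OF one_orbit]] by simp
qed

lemma
  assumes N: "N \<lhd> G" and S: "subgroup (group.torsion (G Mod N) n) (G Mod N)"
  shows preimage_torsion_FactGroup_subgroup: "subgroup {x \<in> carrier G. x [^] n \<in> N} G"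
    and card_preimage_torsion_FactGroup:
      "card {x \<in> carrier G. x [^] n \<in> N} = card (group.torsion (G Mod N) n) * card N"
proof -
  interpret N: normal N G by (rule N)
  interpret Q: group "G Mod N" by (rule N.factorgroup_is_group)
  let ?S = "{x \<in> carrier G. x [^] n \<in> N}"
  have mem: "N #> x \<in> Q.torsion n \<longleftrightarrow> x [^] n \<in> N" if x: "x \<in> carrier G" for x
  proof -
    have "N #> x [^] n = N \<longleftrightarrow> x [^] n \<in> N"
      using coset_join1[of N "x [^] n"] N.rcos_const x N.subgroup_axioms N.subset by auto
    then show ?thesis
      using x N.FactGroup_pow[OF x, of n] by (simp add: Q.torsion_def carrier_FactGroup)
  qed
  have "\<Union> (Q.torsion n) = ?S"
    unfolding N.factgroup_subgroup_union_char[OF S] using mem by auto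
  then show sub: "subgroup ?S G"
    using N.factgroup_subgroup_union_subgroup[OF S] by simp
  have "(\<lambda>x. N #> x) ` ?S = Q.torsion n"
    using mem by (auto simp: Q.torsion_def carrier_FactGroup)
  moreover have "N \<subseteq> ?S"
    using subgroup_nat_pow_closed[OF N.subgroup_axioms] N.subset by auto
  ultimately show "card ?S = card (Q.torsion n) * card N"
    using card_image_rcosets[OF N.subgroup_axioms sub] by simp
qed

lemma k_p'_le_quotient_normal_of_p_index:
  assumes fin: "finite (carrier G)" and p: "Factorial_Ring.prime p" and L: "L \<lhd> G" and N: "N \<lhd> G"
    and ord: "order G = p ^ n * card N"
  shows "k_p' G p \<le> num_conj_orbits (G Mod L) (carrier (G Mod L)) ((\<lambda>x. L #> x) ` N)
    * k_p' (G\<lparr>carrier := L\<rparr>) p"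
proof -
  have "finite N"
    using finite_subset[OF subgroup.subset[OF normal_imp_subgroup[OF N]] fin] .
  then have "num_conj_orbits (G Mod L) (carrier (G Mod L)) ((\<lambda>x. L #> x) ` p'_elements G p)
      \<le> num_conj_orbits (G Mod L) (carrier (G Mod L)) ((\<lambda>x. L #> x) ` N)"
    using p'_elements_subset_normal[OF fin p N ord]
    by (intro num_conj_orbits_mono finite_imageI image_mono)
  then show ?thesis
    using k_p'_le_quotient[OF fin p L] by (meson le_trans mult_le_mono1)
qed

lemma k_p'_le_or_preimage_torsion_subgroup:
  assumes fin: "finite (carrier G)" and p: "Factorial_Ring.prime p"
    and L: "L \<lhd> G" and N: "N \<lhd> G" and "L \<subseteq> N"
    and cardN: "card N = c * card L" and cop: "coprime c p" and ord: "order G = p ^ n * card N"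
  shows "(p + 1) * k_p' G p \<le> 2 * c * k_p' (G\<lparr>carrier := L\<rparr>) p
    \<or> subgroup {x \<in> carrier G. x [^] (p ^ n) \<in> L} G
      \<and> card {x \<in> carrier G. x [^] (p ^ n) \<in> L} = p ^ n * card L"
proof -
  interpret L: normal L G by (rule L)
  interpret N: normal N G by (rule N)
  interpret Q: group "G Mod L" by (rule L.factorgroup_is_group)
  let ?K = "(\<lambda>x. L #> x) ` N"
  let ?orbits = "num_conj_orbits (G Mod L) (carrier (G Mod L)) ?K"
  have finQ: "finite (carrier (G Mod L))"
    using fin by (simp add: carrier_FactGroup)
  have K: "?K \<lhd> G Mod L"
    using normality_factorization[OF L \<open>L \<subseteq> N\<close> N] by (simp add: rcosets_subgroup)
  have cardK: "card ?K = c"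
    using card_image_rcosets[OF L.subgroup_axioms N.subgroup_axioms \<open>L \<subseteq> N\<close>] cardN
      L.finite_imp_card_positive[OF fin] by simp
  have ordQ: "order (G Mod L) = p ^ n * card ?K"
    using order_FactGroup[OF fin L] ord cardN cardK by (simp add: mult.assoc)
  consider (few_orbits) "(p + 1) * ?orbits \<le> 2 * card ?K"
    | (normal_sylow) "subgroup (Q.torsion (p ^ n)) (G Mod L)" "card (Q.torsion (p ^ n)) = p ^ n"
    using Q.num_conj_orbits_le_or_torsion_subgroup[OF finQ p K _ ordQ] cardK cop by blast
  then show ?thesis
  proof cases
    case few_orbits
    have "(p + 1) * k_p' G p \<le> (p + 1) * ?orbits * k_p' (G\<lparr>carrier := L\<rparr>) p"
      unfolding mult.assoc
      by (intro mult_le_mono2 k_p'_le_quotient_normal_of_p_index[OF fin p L N ord])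
    also have "\<dots> \<le> 2 * c * k_p' (G\<lparr>carrier := L\<rparr>) p"
      using few_orbits unfolding cardK by (rule mult_le_mono1)
    finally show ?thesis ..
  next
    case normal_sylow
    then show ?thesis
      using preimage_torsion_FactGroup_subgroup[OF L] card_preimage_torsion_FactGroup[OF L] by simp
  qed
qed

end

section \<open>Densities along normal series\<close>

definition p_extension :: "('a, 'b) monoid_scheme \<Rightarrow> nat \<Rightarrow> 'a set \<Rightarrow> 'a set \<Rightarrow> bool" where
  "p_extension G p N M \<longleftrightarrow> N \<lhd> G \<and> M \<lhd> G \<and> N \<subseteq> M \<and> (\<exists>n. card M = p ^ n * card N)"

definition p'_extension :: "('a, 'b) monoid_scheme \<Rightarrow> nat \<Rightarrow> 'a set \<Rightarrow> 'a set \<Rightarrow> bool" where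
  "p'_extension G p N M \<longleftrightarrow>
     N \<lhd> G \<and> M \<lhd> G \<and> N \<subseteq> M \<and> (\<exists>c. coprime c p \<and> card M = c * card N)"

lemma p_extension_refl: "N \<lhd> G \<Longrightarrow> p_extension G p N N"
  unfolding p_extension_def by (auto intro: exI[of _ 0])

lemma p_extension_trans:
  "\<lbrakk>p_extension G p L N; p_extension G p N M\<rbrakk> \<Longrightarrow> p_extension G p L M"
  unfolding p_extension_def by (auto simp: mult.assoc[symmetric] power_add[symmetric])

lemma p'_extension_refl: "N \<lhd> G \<Longrightarrow> p'_extension G p N N"
  unfolding p'_extension_def by (auto intro: exI[of _ 1])

lemma p'_extension_trans:
  assumes "p'_extension G p L N" and "p'_extension G p N M"
  shows "p'_extension G p L M"
proof -
  obtain c d where "coprime c p" "card N = c * card L" "coprime d p" "card M = d * card N"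
    using assms unfolding p'_extension_def by blast
  then have "coprime (d * c) p" "card M = (d * c) * card L"
    by simp_all
  then show ?thesis
    using assms unfolding p'_extension_def by blast
qed

context group
begin

lemma d_p'_subgroup:
  assumes "finite (carrier G)" and "Factorial_Ring.prime p" and H: "subgroup H G"
  shows "d_p' (G\<lparr>carrier := H\<rparr>) p = real (k_p' (G\<lparr>carrier := H\<rparr>) p) / real (p'_part p (card H))"
  using order_p'_eq_p'_part[of p "G\<lparr>carrier := H\<rparr>"] subgroup.finite_imp_card_positive[OF H] assms
  by (simp add: d_p'_def order_def)

lemma d_p'_trivial_le_one: "d_p' (G\<lparr>carrier := {\<one>}\<rparr>) p \<le> 1"
proof -
  let ?T = "G\<lparr>carrier := {\<one>}\<rparr>"
  have "conj_class ?T ` p'_elements ?T p \<subseteq> {conj_class ?T \<one>}"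
    by (auto simp: p'_elements_def)
  then have "k_p' ?T p \<le> 1"
    unfolding k_p'_def using card_mono[of "{conj_class ?T \<one>}"] by fastforce
  moreover have "order_p' ?T p = 1"
    unfolding order_p'_def by (rule Max_eqI) (auto simp: order_def)
  ultimately show ?thesis
    by (simp add: d_p'_def)
qed

lemma d_p'_p_extension_le:
  assumes fin: "finite (carrier G)" and p: "Factorial_Ring.prime p" and ext: "p_extension G p N M"
  shows "d_p' (G\<lparr>carrier := M\<rparr>) p \<le> d_p' (G\<lparr>carrier := N\<rparr>) p"
proof -
  obtain n where n: "card M = p ^ n * card N" and N: "N \<lhd> G" and M: "M \<lhd> G" and "N \<subseteq> M"
    using ext by (auto simp: p_extension_def)
  interpret N: normal N G by (rule N)
  interpret M: normal M G by (rule M)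
  interpret GM: group "G\<lparr>carrier := M\<rparr>"
    by (rule subgroup_imp_group[OF M.subgroup_axioms])
  have "N \<lhd> G\<lparr>carrier := M\<rparr>"
    by (rule normal_restrict_supergroup[OF M.subgroup_axioms N \<open>N \<subseteq> M\<close>])
  then have "k_p' (G\<lparr>carrier := M\<rparr>) p \<le> k_p' (G\<lparr>carrier := N\<rparr>) p"
    using GM.k_p'_le_normal_of_p_index[of p N n] p finite_subset[OF M.subset fin] n
    by (simp add: order_def)
  moreover have "p'_part p (card M) = p'_part p (card N)"
    using p prime_gt_0_nat[OF p] N.finite_imp_card_positive[OF fin]
    by (simp add: n p'_part_mult p'_part_prime_power)
  ultimately show ?thesis
    by (simp add: d_p'_subgroup[OF fin p] N.subgroup_axioms M.subgroup_axioms divide_right_mono)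
qed

lemma d_p'_p'_extension_le:
  assumes fin: "finite (carrier G)" and p: "Factorial_Ring.prime p" and ext: "p'_extension G p N M"
  shows "d_p' (G\<lparr>carrier := M\<rparr>) p \<le> d_p' (G\<lparr>carrier := N\<rparr>) p"
proof -
  obtain c where c: "card M = c * card N" "coprime c p"
    and N: "N \<lhd> G" and M: "M \<lhd> G" and "N \<subseteq> M"
    using ext by (auto simp: p'_extension_def)
  interpret N: normal N G by (rule N)
  interpret M: normal M G by (rule M)
  interpret GM: group "G\<lparr>carrier := M\<rparr>"
    by (rule subgroup_imp_group[OF M.subgroup_axioms])
  have "N \<lhd> G\<lparr>carrier := M\<rparr>"
    by (rule normal_restrict_supergroup[OF M.subgroup_axioms N \<open>N \<subseteq> M\<close>])
  then have "k_p' (G\<lparr>carrier := M\<rparr>) p \<le> c * k_p' (G\<lparr>carrier := N\<rparr>) p"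
    using GM.k_p'_le_index_mult[OF _ p] finite_subset[OF M.subset fin] c(1)
    by (simp add: order_def)
  then have "real (k_p' (G\<lparr>carrier := M\<rparr>) p) \<le> real c * real (k_p' (G\<lparr>carrier := N\<rparr>) p)"
    by (metis of_nat_le_iff of_nat_mult)
  moreover have "c > 0"
    using M.finite_imp_card_positive[OF fin] c(1) by (cases c) simp_all
  moreover have "p'_part p (card M) = c * p'_part p (card N)"
    using p c \<open>c > 0\<close> N.finite_imp_card_positive[OF fin] by (simp add: p'_part_mult p'_part_coprime)
  moreover have "p'_part p (card N) > 0"
    by (rule p'_part_pos[OF N.finite_imp_card_positive[OF fin]])
  ultimately show ?thesis
    by (simp add: d_p'_subgroup[OF fin p] N.subgroup_axioms M.subgroup_axioms field_simps)
qed

lemma preimage_pow_normal: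
  assumes L: "L \<lhd> G" and M: "M \<lhd> G" and sub: "subgroup {x \<in> M. x [^] (n::nat) \<in> L} G"
  shows "{x \<in> M. x [^] n \<in> L} \<lhd> G"
  unfolding normal_inv_iff
proof (intro conjI ballI sub)
  interpret L: normal L G by (rule L)
  interpret M: normal M G by (rule M)
  fix g x assume g: "g \<in> carrier G" and x: "x \<in> {x \<in> M. x [^] n \<in> L}"
  have "(g \<otimes> x \<otimes> inv g) [^] n = g \<otimes> x [^] n \<otimes> inv g"
    using conj_pow g x by auto
  then show "g \<otimes> x \<otimes> inv g \<in> {x \<in> M. x [^] n \<in> L}"
    using g x by (simp add: L.inv_op_closed2 M.inv_op_closed2)
qed

lemma k_p'_le_or_p_extension_exchange:
  assumes fin: "finite (carrier G)" and p: "Factorial_Ring.prime p"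
    and L: "L \<lhd> G" and N: "N \<lhd> G" and M: "M \<lhd> G" and "L \<subseteq> N" "N \<subseteq> M"
    and cardN: "card N = c * card L" "coprime c p" and cardM: "card M = p ^ n * card N"
  shows "(p + 1) * k_p' (G\<lparr>carrier := M\<rparr>) p \<le> 2 * c * k_p' (G\<lparr>carrier := L\<rparr>) p
    \<or> (\<exists>S. p_extension G p L S \<and> p'_extension G p S M)"
proof -
  interpret L: normal L G by (rule L)
  interpret M: normal M G by (rule M)
  interpret GM: group "G\<lparr>carrier := M\<rparr>"
    by (rule subgroup_imp_group[OF M.subgroup_axioms])
  define S where "S = {x \<in> M. x [^] (p ^ n) \<in> L}"
  have "L \<subseteq> M"
    using \<open>L \<subseteq> N\<close> \<open>N \<subseteq> M\<close> by blast
  have "L \<lhd> G\<lparr>carrier := M\<rparr>" and "N \<lhd> G\<lparr>carrier := M\<rparr>"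
    using normal_restrict_supergroup[OF M.subgroup_axioms] L N \<open>L \<subseteq> M\<close> \<open>N \<subseteq> M\<close> by blast+
  then consider
      (few_classes) "(p + 1) * k_p' (G\<lparr>carrier := M\<rparr>) p \<le> 2 * c * k_p' (G\<lparr>carrier := L\<rparr>) p"
    | (preimage_subgroup) "subgroup S (G\<lparr>carrier := M\<rparr>)" and "card S = p ^ n * card L"
    using GM.k_p'_le_or_preimage_torsion_subgroup[of p L N c n] finite_subset[OF M.subset fin]
      p \<open>L \<subseteq> N\<close> cardN cardM by (auto simp: S_def order_def simp flip: nat_pow_consistent)
  then show ?thesis
  proof cases
    case preimage_subgroup
    have "S \<lhd> G"
      using preimage_pow_normal[OF L M] incl_subgroup[OF M.subgroup_axioms preimage_subgroup(1)]
      by (simp add: S_def)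
    moreover have "L \<subseteq> S"
      using \<open>L \<subseteq> M\<close> subgroup_nat_pow_closed[OF L.subgroup_axioms] by (auto simp: S_def)
    moreover have "card M = c * card S"
      using cardM cardN(1) preimage_subgroup(2) by simp
    moreover have "S \<subseteq> M"
      by (auto simp: S_def)
    ultimately show ?thesis
      using L M preimage_subgroup(2) cardN(2) unfolding p_extension_def p'_extension_def by blast
  qed simp
qed

lemma d_p'_le_or_p_extension_exchange:
  assumes fin: "finite (carrier G)" and p: "Factorial_Ring.prime p"
    and LN: "p'_extension G p L N" and NM: "p_extension G p N M"
  shows "d_p' (G\<lparr>carrier := M\<rparr>) p \<le> 2 / (real p + 1) * d_p' (G\<lparr>carrier := L\<rparr>) p
    \<or> (\<exists>S. p_extension G p L S \<and> p'_extension G p S M)"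
proof (rule disjCI)
  assume no_exchange: "\<nexists>S. p_extension G p L S \<and> p'_extension G p S M"
  obtain c where c: "card N = c * card L" "coprime c p"
    using LN by (auto simp: p'_extension_def)
  obtain n where n: "card M = p ^ n * card N"
    using NM by (auto simp: p_extension_def)
  have normal: "L \<lhd> G" "N \<lhd> G" "M \<lhd> G" "L \<subseteq> N" "N \<subseteq> M"
    using LN NM by (auto simp: p_extension_def p'_extension_def)
  interpret L: normal L G by (rule normal)
  interpret N: normal N G by (rule normal)
  interpret M: normal M G by (rule normal)
  have pos: "card L > 0" "p'_part p (card L) > 0" "c > 0"
    using L.finite_imp_card_positive[OF fin] N.finite_imp_card_positive[OF fin] c(1)
    by (auto intro: p'_part_pos gr0I)
  have "p'_part p (card M) = c * p'_part p (card L)"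
    using p prime_gt_0_nat[OF p] pos c(2)
    by (simp add: n c(1) p'_part_mult p'_part_prime_power p'_part_coprime)
  then have d_M: "d_p' (G\<lparr>carrier := M\<rparr>) p
      = real (k_p' (G\<lparr>carrier := M\<rparr>) p) / (real c * real (p'_part p (card L)))"
    by (simp add: d_p'_subgroup[OF fin p M.subgroup_axioms])
  have "real ((p + 1) * k_p' (G\<lparr>carrier := M\<rparr>) p) \<le> real (2 * c * k_p' (G\<lparr>carrier := L\<rparr>) p)"
    using k_p'_le_or_p_extension_exchange[OF fin p normal c n] no_exchange of_nat_mono by blast
  then have "real (k_p' (G\<lparr>carrier := M\<rparr>) p)
      \<le> 2 / (real p + 1) * (real c * real (k_p' (G\<lparr>carrier := L\<rparr>) p))"
    by (simp add: field_simps)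
  then have "d_p' (G\<lparr>carrier := M\<rparr>) p
      \<le> 2 / (real p + 1) * (real c * real (k_p' (G\<lparr>carrier := L\<rparr>) p))
        / (real c * real (p'_part p (card L)))"
    unfolding d_M by (rule divide_right_mono) simp
  also have "\<dots> = 2 / (real p + 1) * d_p' (G\<lparr>carrier := L\<rparr>) p"
    using pos by (simp add: d_p'_subgroup[OF fin p L.subgroup_axioms])
  finally show "d_p' (G\<lparr>carrier := M\<rparr>) p \<le> 2 / (real p + 1) * d_p' (G\<lparr>carrier := L\<rparr>) p" .
qed

end

section \<open>Shortest normal series\<close>

primrec p_length_at_most :: "('a, 'b) monoid_scheme \<Rightarrow> nat \<Rightarrow> nat \<Rightarrow> 'a set \<Rightarrow> bool" where
  "p_length_at_most G p 0 M \<longleftrightarrow> p'_extension G p {\<one>\<^bsub>G\<^esub>} M"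
| "p_length_at_most G p (Suc k) M \<longleftrightarrow>
     (\<exists>L N. p_length_at_most G p k L \<and> p_extension G p L N \<and> p'_extension G p N M)"

definition p_chain :: "('a, 'b) monoid_scheme \<Rightarrow> nat \<Rightarrow> nat \<Rightarrow> (nat \<Rightarrow> 'a set) \<Rightarrow> bool" where
  "p_chain G p n H \<longleftrightarrow> H 0 = {\<one>\<^bsub>G\<^esub>} \<and>
     (\<forall>i<n. p_extension G p (H i) (H (Suc i)) \<or> p'_extension G p (H i) (H (Suc i)))"

lemma p_length_at_most_p'_extension:
  "\<lbrakk>p_length_at_most G p k N; p'_extension G p N M\<rbrakk> \<Longrightarrow> p_length_at_most G p k M"
  by (cases k) (auto intro: p'_extension_trans)

lemma p_length_at_most_p_extension:
  "\<lbrakk>p_length_at_most G p k N; p_extension G p N M\<rbrakk> \<Longrightarrow> p_length_at_most G p (Suc k) M"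
  by (auto simp: p_extension_def intro: p'_extension_refl)

lemma p_length_at_most_mono:
  assumes "p_length_at_most G p k M" and "k \<le> l"
  shows "p_length_at_most G p l M"
  using assms(2)
proof (induction l rule: dec_induct)
  case (step l)
  have "M \<lhd> G"
    using step.IH by (cases l) (auto simp: p'_extension_def)
  then show ?case
    using p_length_at_most_p_extension[OF step.IH p_extension_refl] by blast
qed (rule assms(1))

lemma num_p_factors_Suc:
  "num_p_factors p (Suc n) H
    = num_p_factors p n H + (if \<exists>m>0. factor_order H n = p ^ m then 1 else 0)"
proof -
  have "{i. i < Suc n \<and> P i} = (if P n then insert n {i. i < n \<and> P i} else {i. i < n \<and> P i})"
    for P :: "nat \<Rightarrow> bool"
    by (auto simp: less_Suc_eq)
  then show ?thesis
    by (simp add: num_p_factors_def)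
qed

lemma num_p_factors_cong:
  assumes "\<And>i. i \<le> n \<Longrightarrow> H i = H' i"
  shows "num_p_factors p n H = num_p_factors p n H'"
  unfolding num_p_factors_def factor_order_def
  using assms by (intro arg_cong[where f = card] Collect_cong conj_cong) simp_all

context group
begin

lemma
  assumes fin: "finite (carrier G)" and N: "N \<lhd> G" and M: "M \<lhd> G" and "N \<subseteq> M"
  shows p_extension_iff_index: "p_extension G p N M \<longleftrightarrow> (\<exists>m. card M div card N = p ^ m)"
    and p'_extension_iff_index: "p'_extension G p N M \<longleftrightarrow> coprime (card M div card N) p"
proof -
  have "card N > 0"
    using subgroup.finite_imp_card_positive[OF normal_imp_subgroup[OF N] fin] .
  moreover have "card N dvd card M"
    using N M \<open>N \<subseteq> M\<close> by (intro card_subgroup_dvd normal_imp_subgroup)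
  ultimately have "card M = c * card N \<longleftrightarrow> card M div card N = c" for c
    by auto
  then show "p_extension G p N M \<longleftrightarrow> (\<exists>m. card M div card N = p ^ m)"
    and "p'_extension G p N M \<longleftrightarrow> coprime (card M div card N) p"
    using N M \<open>N \<subseteq> M\<close> by (auto simp: p_extension_def p'_extension_def)
qed

lemma proper_p_power_index_iff:
  assumes fin: "finite (carrier G)" and p: "Factorial_Ring.prime p"
    and ext: "p_extension G p N M \<or> p'_extension G p N M"
  shows "(\<exists>m>0. card M div card N = p ^ m) \<longleftrightarrow> \<not> p'_extension G p N M"
proof -
  have normal: "N \<lhd> G" "M \<lhd> G" "N \<subseteq> M"
    using ext by (auto simp: p_extension_def p'_extension_def)
  have "\<not> coprime (p ^ m) p" if "m > 0" for m
    using that not_prime_unit[of p] p by auto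
  moreover have "coprime (p ^ 0) p"
    by simp
  ultimately show ?thesis
    using ext unfolding p_extension_iff_index[OF fin normal] p'_extension_iff_index[OF fin normal]
    by (metis gr0I)
qed

lemma p_series_iff_p_chain:
  assumes fin: "finite (carrier G)"
  shows "p_series G p n H \<longleftrightarrow> p_chain G p n H \<and> H n = carrier G"
proof
  assume "p_series G p n H"
  then show "p_chain G p n H \<and> H n = carrier G"
    by (simp add: p_series_def p_chain_def factor_order_def p_extension_iff_index[OF fin]
        p'_extension_iff_index[OF fin])
next
  assume chain: "p_chain G p n H \<and> H n = carrier G"
  have ext: "p_extension G p (H i) (H (Suc i)) \<or> p'_extension G p (H i) (H (Suc i))"
    if "i < n" for i
    using chain that by (simp add: p_chain_def)
  then have normal: "H i \<lhd> G" "H (Suc i) \<lhd> G" "H i \<subseteq> H (Suc i)" if "i < n" for i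
    using that by (auto simp: p_extension_def p'_extension_def)
  have "H i \<lhd> G" if "i \<le> n" for i
  proof (cases i)
    case 0
    then show ?thesis
      using chain one_is_normal by (simp add: p_chain_def)
  next
    case (Suc j)
    then show ?thesis
      using normal(2)[of j] that by simp
  qed
  moreover have "(\<exists>m. factor_order H i = p ^ m) \<or> coprime (factor_order H i) p" if "i < n" for i
    using ext[OF that] p_extension_iff_index[OF fin normal[OF that]]
      p'_extension_iff_index[OF fin normal[OF that]]
    by (simp add: factor_order_def)
  ultimately show "p_series G p n H"
    using chain normal(3) by (simp add: p_series_def p_chain_def)
qed

lemma p_chain_imp_p_length_at_most:
  assumes fin: "finite (carrier G)" and p: "Factorial_Ring.prime p"
  shows "p_chain G p n H \<Longrightarrow> p_length_at_most G p (num_p_factors p n H) (H n)"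
proof (induction n)
  case 0
  then show ?case
    using p'_extension_refl[OF one_is_normal] by (simp add: p_chain_def num_p_factors_def)
next
  case (Suc n)
  then have ext: "p_extension G p (H n) (H (Suc n)) \<or> p'_extension G p (H n) (H (Suc n))"
    and IH: "p_length_at_most G p (num_p_factors p n H) (H n)"
    by (simp_all add: p_chain_def)
  have "num_p_factors p (Suc n) H
      = num_p_factors p n H + (if p'_extension G p (H n) (H (Suc n)) then 0 else 1)"
    using proper_p_power_index_iff[OF fin p ext] by (simp add: num_p_factors_Suc factor_order_def)
  then show ?case
    using ext p_length_at_most_p_extension[OF IH] p_length_at_most_p'_extension[OF IH]
    by (auto simp del: p_length_at_most.simps)
qed

lemma p_chain_extend:
  assumes fin: "finite (carrier G)" and p: "Factorial_Ring.prime p" and chain: "p_chain G p n H"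
    and ext: "p_extension G p (H n) M \<or> p'_extension G p (H n) M"
  obtains H' where "p_chain G p (Suc n) H'" "H' (Suc n) = M"
    "num_p_factors p (Suc n) H' \<le> Suc (num_p_factors p n H)"
    "p'_extension G p (H n) M \<Longrightarrow> num_p_factors p (Suc n) H' = num_p_factors p n H"
proof
  let ?H = "H(Suc n := M)"
  show "p_chain G p (Suc n) ?H"
    using chain ext by (auto simp: p_chain_def less_Suc_eq)
  have "num_p_factors p n ?H = num_p_factors p n H"
    by (rule num_p_factors_cong) simp
  then have "num_p_factors p (Suc n) ?H
      = num_p_factors p n H + (if p'_extension G p (H n) M then 0 else 1)"
    using proper_p_power_index_iff[OF fin p ext] by (simp add: num_p_factors_Suc factor_order_def)
  then show "num_p_factors p (Suc n) ?H \<le> Suc (num_p_factors p n H)"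
    and "p'_extension G p (H n) M \<Longrightarrow> num_p_factors p (Suc n) ?H = num_p_factors p n H"
    by simp_all
qed simp

lemma p_length_at_most_imp_p_chain:
  assumes fin: "finite (carrier G)" and p: "Factorial_Ring.prime p"
  shows "p_length_at_most G p k M \<Longrightarrow> \<exists>n H. p_chain G p n H \<and> H n = M \<and> num_p_factors p n H \<le> k"
proof (induction k arbitrary: M)
  case 0
  have "p_chain G p 0 (\<lambda>_. {\<one>})" and "num_p_factors p 0 (\<lambda>_. {\<one>}) = 0"
    by (simp_all add: p_chain_def num_p_factors_def)
  moreover have "p'_extension G p {\<one>} M"
    using 0 by simp
  ultimately obtain H where "p_chain G p (Suc 0) H" "H (Suc 0) = M" "num_p_factors p (Suc 0) H = 0"
    using p_chain_extend[OF fin p, of 0 "\<lambda>_. {\<one>}" M] by metis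
  then show ?case
    by (intro exI[of _ "Suc 0"] exI[of _ H]) simp
next
  case (Suc k)
  then obtain L N where LN: "p_length_at_most G p k L" "p_extension G p L N" "p'_extension G p N M"
    by auto
  obtain n H where H: "p_chain G p n H" "H n = L" "num_p_factors p n H \<le> k"
    using Suc.IH[OF LN(1)] by blast
  obtain H' where H': "p_chain G p (Suc n) H'" "H' (Suc n) = N"
      "num_p_factors p (Suc n) H' \<le> Suc (num_p_factors p n H)"
    using p_chain_extend[OF fin p H(1), of N] LN(2) H(2) by blast
  obtain H'' where "p_chain G p (Suc (Suc n)) H''" "H'' (Suc (Suc n)) = M"
      "num_p_factors p (Suc (Suc n)) H'' = num_p_factors p (Suc n) H'"
    using p_chain_extend[OF fin p H'(1), of M] LN(3) H'(2) by blast
  then show ?case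
    using le_trans[OF H'(3)] H(3) by (intro exI[of _ "Suc (Suc n)"] exI[of _ H'']) simp
qed

lemma p_length_at_most_carrier_iff:
  assumes fin: "finite (carrier G)" and p: "Factorial_Ring.prime p"
  shows "p_length_at_most G p k (carrier G) \<longleftrightarrow> p_solvable G p \<and> p_length G p \<le> k"
proof
  assume "p_length_at_most G p k (carrier G)"
  then obtain n H where series: "p_series G p n H" and "num_p_factors p n H \<le> k"
    using p_length_at_most_imp_p_chain[OF fin p] p_series_iff_p_chain[OF fin] by blast
  moreover have "p_length G p \<le> num_p_factors p n H"
    unfolding p_length_def using series by (intro Least_le) blast
  ultimately show "p_solvable G p \<and> p_length G p \<le> k"
    by (auto simp: p_solvable_def)
next
  assume solvable: "p_solvable G p \<and> p_length G p \<le> k"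
  then have "\<exists>k n H. p_series G p n H \<and> num_p_factors p n H = k"
    by (simp add: p_solvable_def)
  then have "\<exists>n H. p_series G p n H \<and> num_p_factors p n H = p_length G p"
    unfolding p_length_def by (rule LeastI_ex)
  then have "p_length_at_most G p (p_length G p) (carrier G)"
    using p_chain_imp_p_length_at_most[OF fin p] p_series_iff_p_chain[OF fin] by metis
  then show "p_length_at_most G p k (carrier G)"
    using p_length_at_most_mono solvable by blast
qed

lemma d_p'_le_one:
  assumes fin: "finite (carrier G)" and p: "Factorial_Ring.prime p"
  shows "p_length_at_most G p k M \<Longrightarrow> d_p' (G\<lparr>carrier := M\<rparr>) p \<le> 1"
proof (induction k arbitrary: M)
  case 0
  then show ?case
    using d_p'_p'_extension_le[OF fin p] d_p'_trivial_le_one by (force intro: order_trans)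
next
  case (Suc k)
  then obtain L N where "p_length_at_most G p k L" "p_extension G p L N" "p'_extension G p N M"
    by auto
  then show ?case
    using Suc.IH d_p'_p_extension_le[OF fin p] d_p'_p'_extension_le[OF fin p] by (meson order_trans)
qed

text \<open>In a shortest series, the second of two successive \<open>p\<close>-factors cannot be moved below the
  \<open>p'\<close>-factor between them, for it would merge with the first.\<close>
lemma d_p'_le_power:
  assumes fin: "finite (carrier G)" and p: "Factorial_Ring.prime p"
  shows "\<lbrakk>p_length_at_most G p (Suc k) M; \<not> p_length_at_most G p k M\<rbrakk>
    \<Longrightarrow> d_p' (G\<lparr>carrier := M\<rparr>) p \<le> (2 / (real p + 1)) ^ k"
proof (induction k arbitrary: M)
  case 0
  then show ?case
    using d_p'_le_one[OF fin p] by (simp only: power_0)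
next
  case (Suc k)
  let ?r = "2 / (real p + 1)"
  let ?d = "\<lambda>M. d_p' (G\<lparr>carrier := M\<rparr>) p"
  obtain N N' where N: "p_length_at_most G p (Suc k) N" "p_extension G p N N'"
      "p'_extension G p N' M"
    using Suc.prems(1) by (auto simp only: p_length_at_most.simps(2))
  obtain L' L where L: "p_length_at_most G p k L'" "p_extension G p L' L" "p'_extension G p L N"
    using N(1) by auto
  have minimal: "\<not> p_length_at_most G p (Suc k) N'"
    using Suc.prems(2) N(3) p_length_at_most_p'_extension by blast
  then have "\<not> p_length_at_most G p k L"
    using N(2) L(3) p_length_at_most_p_extension p_length_at_most_p'_extension by blast
  then have IH: "?d L \<le> ?r ^ k"
    using Suc.IH p_length_at_most_p_extension[OF L(1,2)] by blast
  have no_exchange: "\<nexists>S. p_extension G p L S \<and> p'_extension G p S N'"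
    using minimal L(1,2) p_extension_trans p_length_at_most_p_extension
      p_length_at_most_p'_extension by blast
  have "?d M \<le> ?d N'"
    by (rule d_p'_p'_extension_le[OF fin p N(3)])
  also have "\<dots> \<le> ?r * ?d L"
    using d_p'_le_or_p_extension_exchange[OF fin p L(3) N(2)] no_exchange by blast
  also have "\<dots> \<le> ?r ^ Suc k"
    using mult_left_mono[OF IH, of ?r] by simp
  finally show ?case .
qed

end

theorem theorem1p4:
  fixes G :: "('a, 'b) monoid_scheme" and p k :: nat
  assumes "group G" and "finite (carrier G)" and "Factorial_Ring.prime p"
    and "p_solvable G p" and "p_length G p = k"
  shows "d_p' G p \<le> (2 / (real p + 1)) powi (int k - 1)"
proof -
  interpret group G by fact
  have at_most: "p_length_at_most G p j (carrier G) \<longleftrightarrow> k \<le> j" for j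
    using p_length_at_most_carrier_iff[OF assms(2,3)] assms(4,5) by simp
  show ?thesis
  proof (cases k)
    case 0
    have "d_p' G p \<le> 1"
      using d_p'_le_one[OF assms(2,3), of k "carrier G"] at_most by simp
    also have "1 \<le> inverse (2 / (real p + 1))"
      using prime_gt_0_nat[OF assms(3)] by (simp add: field_simps)
    finally show ?thesis
      using 0 by (simp add: power_int_minus)
  next
    case (Suc j)
    then have "d_p' G p \<le> (2 / (real p + 1)) ^ j"
      using d_p'_le_power[OF assms(2,3), of j "carrier G"] at_most[of j] at_most[of "Suc j"] by simp
    then show ?thesis
      using Suc by simp
  qed
qed

end
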